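(* Let $P$ and $\tilde P$ be irreducible, positive recurrent stochastic matrices on a countable (finite or infinite) state space $\mathbb{E}$, with unique invariant probability measures $\pi$ and $\nu$ respectively, and let $\Delta=\tilde P-P$. Suppose that the state space $\mathbb{E}$ is $\nu_m$-small (for $P$) for some positive integer $m$ and some non-trivial measure $\nu_m$ on the collection of all subsets of $\mathbb{E}$, i.e. $\sum_{k\in B}P^m(i,k)\ge \nu_m(B)$ for all $i\in\mathbb{E}$ and all $B\subseteq\mathbb{E}$. Then $$\|\nu-\pi\|\le \frac{\|P^m-\tilde P^m\|}{\nu_m(\mathbb{E})}\le \frac{m}{\nu_m(\mathbb{E})}\,\|\Delta\|.$$ In particular, if there exists a positive integer $m$ such that $\sum_{k\in\mathbb{E}}\delta_m(k)>0$, where $\delta_m(k):=\inf_{i\in\mathbb{E}}P^m(i,k)$, then $$\|\nu-\pi\|\le \frac{\|P^m-\tilde P^m\|}{\sum_{k\in\mathbb{E}}\delta_m(k)}\le \frac{m}{\sum_{k\in\mathbb{E}}\delta_m(k)}\,\|\Delta\|.$$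
   Context: $P^m=(P^m(i,j))$ is the $m$-th power of $P$ ($m$-step transition matrix). A non-trivial measure is a (non-negative) measure $\mu$ with $\mu(\mathbb{E})>0$. Norms: for a signed finite measure (row vector) $\mu$ on $\mathbb{E}$, $\|\mu\|=\sum_{i\in\mathbb{E}}|\mu(i)|$; for a matrix $L=(L_{ij})$ on $\mathbb{E}\times\mathbb{E}$, $\|L\|=\sup_{i\in\mathbb{E}}\sum_{j\in\mathbb{E}}|L_{ij}|$. The invariant probability measures satisfy $\pi P=\pi$ and $\nu\tilde P=\nu$. *)

theory Defs
  imports "HOL-Analysis.Analysis"
begin

text \<open>The state space is the universe of a type \<open>'a\<close> of class \<open>countable\<close>, so it is nonempty and
  finite or countably infinite. Matrices are functions of type \<open>'a \<Rightarrow> 'a \<Rightarrow> real\<close>, row vectors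
  functions of type \<open>'a \<Rightarrow> real\<close>.\<close>

definition stochastic :: "('a \<Rightarrow> 'a \<Rightarrow> real) \<Rightarrow> bool" where
  "stochastic P \<longleftrightarrow> (\<forall>i j. 0 \<le> P i j) \<and> (\<forall>i. (P i has_sum 1) UNIV)"

primrec mat_pow :: "('a \<Rightarrow> 'a \<Rightarrow> real) \<Rightarrow> nat \<Rightarrow> 'a \<Rightarrow> 'a \<Rightarrow> real" where
  "mat_pow P 0 i j = (if i = j then 1 else 0)"
| "mat_pow P (Suc n) i j = (\<Sum>\<^sub>\<infinity>k. mat_pow P n i k * P k j)"

definition irreducible_mat :: "('a \<Rightarrow> 'a \<Rightarrow> real) \<Rightarrow> bool" where
  "irreducible_mat P \<longleftrightarrow> (\<forall>i j. \<exists>n\<ge>1. 0 < mat_pow P n i j)"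

text \<open>\<open>first_passage P n i j\<close> is the probability that the chain started in \<open>i\<close> visits \<open>j\<close> for the
  first time after time 0 at time \<open>n\<close>. The recursion conditions on the first step, which must
  avoid \<open>j\<close>.\<close>

fun first_passage :: "('a \<Rightarrow> 'a \<Rightarrow> real) \<Rightarrow> nat \<Rightarrow> 'a \<Rightarrow> 'a \<Rightarrow> real" where
  "first_passage P 0 i j = 0"
| "first_passage P (Suc 0) i j = P i j"
| "first_passage P (Suc (Suc n)) i j =
     (\<Sum>\<^sub>\<infinity>k\<in>- {j}. P i k * first_passage P (Suc n) k j)"

text \<open>Return to every state is almost sure and has finite expected time.\<close>

definition positive_recurrent :: "('a \<Rightarrow> 'a \<Rightarrow> real) \<Rightarrow> bool" where
  "positive_recurrent P \<longleftrightarrow>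
     (\<forall>i. (\<lambda>n. first_passage P n i i) sums 1 \<and>
          summable (\<lambda>n. real n * first_passage P n i i))"

definition invariant_prob :: "('a \<Rightarrow> 'a \<Rightarrow> real) \<Rightarrow> ('a \<Rightarrow> real) \<Rightarrow> bool" where
  "invariant_prob P \<pi> \<longleftrightarrow>
     (\<forall>i. 0 \<le> \<pi> i) \<and> (\<pi> has_sum 1) UNIV \<and>
     (\<forall>j. ((\<lambda>i. \<pi> i * P i j) has_sum \<pi> j) UNIV)"

text \<open>The two norms are real-valued, hence meaningful only where they are finite: for vectors that
  are absolutely summable, respectively for matrices whose absolute row sums exist and are bounded.
  Differences of probability vectors and of stochastic matrices satisfy this.\<close>

definition vec_norm :: "('a \<Rightarrow> real) \<Rightarrow> real" where
  "vec_norm \<mu> = (\<Sum>\<^sub>\<infinity>i. \<bar>\<mu> i\<bar>)"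

definition mat_norm :: "('a \<Rightarrow> 'a \<Rightarrow> real) \<Rightarrow> real" where
  "mat_norm L = (SUP i. \<Sum>\<^sub>\<infinity>j. \<bar>L i j\<bar>)"

text \<open>The whole state space is \<open>M\<close>-small for \<open>P\<close> with step number \<open>m\<close>, where \<open>M\<close> is a non-trivial
  measure on all subsets. Taking \<open>B = UNIV\<close> shows that \<open>M\<close> is finite if \<open>P\<close> is stochastic.\<close>

definition space_small :: "('a \<Rightarrow> 'a \<Rightarrow> real) \<Rightarrow> nat \<Rightarrow> 'a measure \<Rightarrow> bool" where
  "space_small P m M \<longleftrightarrow>
     sets M = UNIV \<and> 0 < emeasure M UNIV \<and>
     (\<forall>i B. emeasure M B \<le> ennreal (\<Sum>\<^sub>\<infinity>k\<in>B. mat_pow P m i k))"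

definition delta :: "('a \<Rightarrow> 'a \<Rightarrow> real) \<Rightarrow> nat \<Rightarrow> 'a \<Rightarrow> real" where
  "delta P m k = (INF i. mat_pow P m i k)"

end

theory Submission
  imports Defs
begin

text \<open>Suppose \<open>d\<close> is a nonnegative row vector of total mass \<open>s\<close> lying below every row of
  \<open>P\<^sup>m\<close>. Since \<open>x = \<nu> - \<pi>\<close> has total mass 0, subtracting \<open>d\<close> from every row of \<open>P\<^sup>m\<close> does not
  change \<open>x P\<^sup>m\<close>, so \<open>\<parallel>x P\<^sup>m\<parallel> \<le> (1 - s) \<parallel>x\<parallel>\<close>. Invariance gives
  \<open>x = x P\<^sup>m + \<nu> (P'\<^sup>m - P\<^sup>m)\<close>, hence \<open>s \<parallel>x\<parallel> \<le> \<parallel>P\<^sup>m - P'\<^sup>m\<parallel>\<close>. The second inequality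
  telescopes \<open>P\<^sup>m - P'\<^sup>m\<close>.\<close>

section \<open>Absolute values and differences of real infinite sums\<close>

lemma summable_on_abs_real:
  fixes f :: "'a \<Rightarrow> real"
  shows "f summable_on A \<Longrightarrow> (\<lambda>x. \<bar>f x\<bar>) summable_on A"
  using summable_on_iff_abs_summable_on_real[of f A] unfolding real_norm_def by blast

lemma summable_on_diff_real:
  fixes f g :: "'a \<Rightarrow> real"
  assumes "f summable_on A" and "g summable_on A"
  shows "(\<lambda>x. f x - g x) summable_on A"
  using summable_on_add[of f A "\<lambda>x. - g x"] assms by (simp add: summable_on_uminus)

lemma infsum_diff_real:
  fixes f g :: "'a \<Rightarrow> real"
  assumes "f summable_on A" and "g summable_on A"
  shows "(\<Sum>\<^sub>\<infinity>x\<in>A. f x - g x) = (\<Sum>\<^sub>\<infinity>x\<in>A. f x) - (\<Sum>\<^sub>\<infinity>x\<in>A. g x)"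
  using infsum_add[of f A "\<lambda>x. - g x"] assms by (simp add: summable_on_uminus infsum_uminus)

section \<open>Row vector times matrix with bounded absolute row sums\<close>

text \<open>The iterated sum of \<open>\<bar>x i\<bar> * \<bar>L i j\<bar>\<close> is at most C
  times the absolute sum of x, so the double family is absolutely summable. Every exchange of sums
  below rests on this.\<close>

lemma summable_on_row_product:
  fixes x :: "'a \<Rightarrow> real" and L :: "'a \<Rightarrow> 'b \<Rightarrow> real"
  assumes "x summable_on UNIV" and "\<And>i. L i summable_on UNIV"
    and "\<And>i. (\<Sum>\<^sub>\<infinity>j. \<bar>L i j\<bar>) \<le> C"
  shows "(\<lambda>(i, j). x i * L i j) summable_on UNIV"
proof -
  have absL: "(\<lambda>j. \<bar>L i j\<bar>) summable_on UNIV" for i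
    using assms(2) by (simp add: summable_on_abs_real)
  have absx: "(\<lambda>i. \<bar>x i\<bar>) summable_on UNIV"
    using assms(1) by (simp add: summable_on_abs_real)
  have "(\<lambda>i. \<bar>x i\<bar> * (\<Sum>\<^sub>\<infinity>j. \<bar>L i j\<bar>)) summable_on UNIV"
  proof (rule summable_on_comparison_test)
    show "(\<lambda>i. \<bar>x i\<bar> * C) summable_on UNIV"
      using absx by (rule summable_on_cmult_left)
  qed (auto intro!: mult_left_mono mult_nonneg_nonneg assms(3) infsum_nonneg)
  then have "(\<lambda>p. norm (case p of (i, j) \<Rightarrow> x i * L i j)) summable_on (SIGMA i:UNIV. UNIV)"
    using absL
    by (subst Infinite_Sum.abs_summable_on_Sigma_iff)
      (auto simp: abs_mult infsum_cmult_right' infsum_nonneg intro: summable_on_cmult_right)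
  then show ?thesis
    using abs_summable_summable by fastforce
qed

context
  fixes x :: "'a \<Rightarrow> real" and L :: "'a \<Rightarrow> 'b \<Rightarrow> real" and C :: real
  assumes x: "x summable_on UNIV" and L: "\<And>i. L i summable_on UNIV"
    and C: "\<And>i. (\<Sum>\<^sub>\<infinity>j. \<bar>L i j\<bar>) \<le> C"
begin

text \<open>With j as the outer index, the inner sums are the entries of the product x L, and the
  Sigma rules give their existence and summability.\<close>

private lemma swapped: "(\<lambda>(j, i). x i * L i j) summable_on (SIGMA j:UNIV. UNIV)"
  using summable_on_swap[of "\<lambda>(i, j). x i * L i j" UNIV UNIV]
    summable_on_row_product[of x L, OF x L C]
  by (simp add: case_prod_unfold)

lemma row_product_entry_summable: "(\<lambda>i. x i * L i j) summable_on UNIV"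
  using summable_on_SigmaD1[of "\<lambda>j i. x i * L i j" UNIV "\<lambda>_. UNIV" j] swapped by simp

lemma row_product_summable: "(\<lambda>j. \<Sum>\<^sub>\<infinity>i. x i * L i j) summable_on UNIV"
  using summable_on_Sigma_banach[OF swapped] by simp

lemma infsum_row_product: "(\<Sum>\<^sub>\<infinity>j. \<Sum>\<^sub>\<infinity>i. x i * L i j) = (\<Sum>\<^sub>\<infinity>i. x i * (\<Sum>\<^sub>\<infinity>j. L i j))"
  using infsum_swap_banach[of "\<lambda>i j. x i * L i j" UNIV UNIV] summable_on_row_product[OF x L C]
  by (simp add: infsum_cmult_right')

end

text \<open>This is the operator norm bound for x L: take absolute values inside the inner sum,
  exchange the sums, and bound each row of L by C.\<close>

lemma infsum_abs_row_product_le: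
  fixes x :: "'a \<Rightarrow> real" and L :: "'a \<Rightarrow> 'b \<Rightarrow> real"
  assumes x: "x summable_on UNIV" and L: "\<And>i. L i summable_on UNIV"
    and C: "\<And>i. (\<Sum>\<^sub>\<infinity>j. \<bar>L i j\<bar>) \<le> C"
  shows "(\<Sum>\<^sub>\<infinity>j. \<bar>\<Sum>\<^sub>\<infinity>i. x i * L i j\<bar>) \<le> C * (\<Sum>\<^sub>\<infinity>i. \<bar>x i\<bar>)"
proof -
  have x': "(\<lambda>i. \<bar>x i\<bar>) summable_on UNIV"
    using x by (simp add: summable_on_abs_real)
  have L': "(\<lambda>j. \<bar>L i j\<bar>) summable_on UNIV" for i
    using L by (simp add: summable_on_abs_real)
  have C': "(\<Sum>\<^sub>\<infinity>j. \<bar>\<bar>L i j\<bar>\<bar>) \<le> C" for i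
    using C by simp
  \<comment> \<open>Absolute convergence of each column sum, which the triangle inequality for
    infinite sums requires.\<close>
  note entry = row_product_entry_summable[OF x' L' C']
  have "(\<Sum>\<^sub>\<infinity>j. \<bar>\<Sum>\<^sub>\<infinity>i. x i * L i j\<bar>) \<le> (\<Sum>\<^sub>\<infinity>j. \<Sum>\<^sub>\<infinity>i. \<bar>x i\<bar> * \<bar>L i j\<bar>)"
  proof (rule infsum_mono)
    show "(\<lambda>j. \<bar>\<Sum>\<^sub>\<infinity>i. x i * L i j\<bar>) summable_on UNIV"
      using row_product_summable[OF x L C] by (simp add: summable_on_abs_real)
    show "(\<lambda>j. \<Sum>\<^sub>\<infinity>i. \<bar>x i\<bar> * \<bar>L i j\<bar>) summable_on UNIV"
      by (rule row_product_summable[OF x' L' C'])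
    show "\<bar>\<Sum>\<^sub>\<infinity>i. x i * L i j\<bar> \<le> (\<Sum>\<^sub>\<infinity>i. \<bar>x i\<bar> * \<bar>L i j\<bar>)" for j
      using norm_infsum_bound[of "\<lambda>i. x i * L i j" UNIV] entry by (simp add: abs_mult)
  qed
  also have "\<dots> = (\<Sum>\<^sub>\<infinity>i. \<bar>x i\<bar> * (\<Sum>\<^sub>\<infinity>j. \<bar>L i j\<bar>))"
    by (rule infsum_row_product[OF x' L' C'])
  also have "\<dots> \<le> (\<Sum>\<^sub>\<infinity>i. \<bar>x i\<bar> * C)"
  proof (rule infsum_mono)
    show "(\<lambda>i. \<bar>x i\<bar> * C) summable_on UNIV"
      using x' by (rule summable_on_cmult_left)
    then show "(\<lambda>i. \<bar>x i\<bar> * (\<Sum>\<^sub>\<infinity>j. \<bar>L i j\<bar>)) summable_on UNIV"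
      by (rule summable_on_comparison_test) (auto intro!: mult_left_mono mult_nonneg_nonneg C infsum_nonneg)
  qed (auto intro!: mult_left_mono C)
  finally show ?thesis
    by (simp add: infsum_cmult_left' mult.commute[of C])
qed

section \<open>Stochastic matrices, their powers and invariant vectors\<close>

lemma stochastic_nonneg: "stochastic P \<Longrightarrow> 0 \<le> P i j"
  by (simp add: stochastic_def)

lemma stochastic_summable: "stochastic P \<Longrightarrow> P i summable_on UNIV"
  by (auto simp: stochastic_def summable_on_def)

lemma stochastic_row_sum: "stochastic P \<Longrightarrow> (\<Sum>\<^sub>\<infinity>j. P i j) = 1"
  by (auto simp: stochastic_def intro: infsumI)

lemma stochastic_abs_row_sum: "stochastic P \<Longrightarrow> (\<Sum>\<^sub>\<infinity>j. \<bar>P i j\<bar>) = 1"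
  by (simp add: stochastic_nonneg stochastic_row_sum)

lemma stochastic_row_product_summable:
  assumes "stochastic P" and "x summable_on UNIV"
  shows "(\<lambda>i. x i * P i j) summable_on UNIV"
  by (rule row_product_entry_summable[OF assms(2) stochastic_summable[OF assms(1)]
        order_eq_refl[OF stochastic_abs_row_sum[OF assms(1)]]])

lemma stochastic_mat_pow:
  assumes P: "stochastic P"
  shows "stochastic (mat_pow P n)"
proof (induction n)
  case 0
  have "((\<lambda>j. if i = j then 1 else 0) has_sum (1::real)) UNIV" for i :: 'a
    using has_sum_finite_neutralI[of "{i}" UNIV "\<lambda>j. if i = j then 1 else (0::real)" 1] by auto
  then show ?case
    by (simp add: stochastic_def)
next
  case (Suc n)
  \<comment> \<open>Row i of P^n acts as the vector and P as the matrix; exchanging sums reduces the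
    row sum of the product to that of P^n.\<close>
  note args = stochastic_summable[OF Suc] stochastic_summable[OF P]
    order_eq_refl[OF stochastic_abs_row_sum[OF P]]
  have "(\<Sum>\<^sub>\<infinity>j. mat_pow P (Suc n) i j) = 1" for i
    using infsum_row_product[OF args, of i]
    by (simp add: stochastic_row_sum[OF P] stochastic_row_sum[OF Suc])
  moreover have "mat_pow P (Suc n) i summable_on UNIV" for i
    using row_product_summable[OF args, of i] by (simp cong: summable_on_cong)
  moreover have "0 \<le> mat_pow P (Suc n) i j" for i j
    using stochastic_nonneg[OF P] stochastic_nonneg[OF Suc] by (auto intro!: infsum_nonneg)
  ultimately show ?case
    unfolding stochastic_def by (metis has_sum_infsum)
qed

text \<open>\<open>mat_pow\<close> appends its new factor on the right, so \<pi> P^(n+1) = (\<pi>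
  P^n) P once the sums are exchanged.\<close>

lemma invariant_prob_mat_pow:
  assumes P: "stochastic P" and inv: "invariant_prob P \<pi>"
  shows "(\<Sum>\<^sub>\<infinity>i. \<pi> i * mat_pow P n i j) = \<pi> j"
proof (induction n arbitrary: j)
  case 0
  show ?case
    by (rule infsumI, rule has_sum_finite_neutralI[of "{j}"]) auto
next
  case (Suc n)
  have \<pi>: "\<pi> summable_on UNIV"
    using inv by (auto simp: invariant_prob_def summable_on_def)
  note Pn = stochastic_mat_pow[OF P, of n]
  have le1: "P k j \<le> 1" for k
    using stochastic_row_sum[OF P] stochastic_nonneg[OF P]
      infsum_mono_neutral[of "P k" "{j}" "P k" UNIV] stochastic_summable[OF P, of k]
    by auto
  \<comment> \<open>For fixed j the factor \<open>P k j\<close> is absorbed into the matrix with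
    entries indexed by i and k. Its absolute row sums are at most 1, so the exchange rule applies
    with \<pi> as the vector.\<close>
  have bound: "(\<Sum>\<^sub>\<infinity>k. \<bar>mat_pow P n i k * P k j\<bar>) \<le> 1" for i
  proof -
    have "(\<Sum>\<^sub>\<infinity>k. mat_pow P n i k * P k j) \<le> (\<Sum>\<^sub>\<infinity>k. mat_pow P n i k)"
      using stochastic_row_product_summable[OF P stochastic_summable[OF Pn]]
        stochastic_summable[OF Pn] le1 stochastic_nonneg[OF Pn]
      by (auto intro!: infsum_mono mult_left_le)
    then show ?thesis
      by (simp add: stochastic_row_sum[OF Pn] stochastic_nonneg[OF P] stochastic_nonneg[OF Pn])
  qed
  have "(\<Sum>\<^sub>\<infinity>i. \<pi> i * mat_pow P (Suc n) i j)
      = (\<Sum>\<^sub>\<infinity>k. \<Sum>\<^sub>\<infinity>i. \<pi> i * (mat_pow P n i k * P k j))"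
    using infsum_row_product[OF \<pi> stochastic_row_product_summable[OF P stochastic_summable[OF Pn]] bound]
    by simp
  also have "\<dots> = (\<Sum>\<^sub>\<infinity>k. \<pi> k * P k j)"
    by (simp add: mult.assoc[symmetric] infsum_cmult_left' Suc)
  also have "\<dots> = \<pi> j"
    using inv by (auto simp: invariant_prob_def intro: infsumI)
  finally show ?case .
qed

section \<open>Norms of differences of matrix powers\<close>

lemma infsum_abs_add_le:
  fixes f g :: "'a \<Rightarrow> real"
  assumes "f summable_on UNIV" and "g summable_on UNIV"
  shows "(\<Sum>\<^sub>\<infinity>j. \<bar>f j + g j\<bar>) \<le> (\<Sum>\<^sub>\<infinity>j. \<bar>f j\<bar>) + (\<Sum>\<^sub>\<infinity>j. \<bar>g j\<bar>)"
proof -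
  have abs: "(\<lambda>j. \<bar>f j\<bar>) summable_on UNIV" "(\<lambda>j. \<bar>g j\<bar>) summable_on UNIV"
    "(\<lambda>j. \<bar>f j + g j\<bar>) summable_on UNIV"
    using assms summable_on_add[OF assms] by (simp_all add: summable_on_abs_real)
  have "(\<Sum>\<^sub>\<infinity>j. \<bar>f j + g j\<bar>) \<le> (\<Sum>\<^sub>\<infinity>j. \<bar>f j\<bar> + \<bar>g j\<bar>)"
    using abs by (intro infsum_mono summable_on_add) auto
  also have "\<dots> = (\<Sum>\<^sub>\<infinity>j. \<bar>f j\<bar>) + (\<Sum>\<^sub>\<infinity>j. \<bar>g j\<bar>)"
    using abs by (intro infsum_add)
  finally show ?thesis .
qed

lemma infsum_abs_minus_commute:
  fixes f g :: "'a \<Rightarrow> real"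
  shows "(\<Sum>\<^sub>\<infinity>j. \<bar>f j - g j\<bar>) = (\<Sum>\<^sub>\<infinity>j. \<bar>g j - f j\<bar>)"
  by (simp add: abs_minus_commute)

lemma stochastic_diff_summable:
  "stochastic P \<Longrightarrow> stochastic Q \<Longrightarrow> (\<lambda>j. P i j - Q i j) summable_on UNIV"
  by (simp add: stochastic_summable summable_on_diff_real)

lemma stochastic_diff_row_sum_le_mat_norm:
  assumes P: "stochastic P" and Q: "stochastic Q"
  shows "(\<Sum>\<^sub>\<infinity>j. \<bar>P i j - Q i j\<bar>) \<le> mat_norm (\<lambda>i j. P i j - Q i j)"
  unfolding mat_norm_def
proof (rule cSUP_upper)
  \<comment> \<open>The bound 2 adds the two row sums 1; it makes the real supremum in
    \<open>mat_norm\<close> an upper bound for the rows.\<close>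
  have "(\<Sum>\<^sub>\<infinity>j. \<bar>P k j - Q k j\<bar>) \<le> 2" for k
    using infsum_abs_add_le[of "P k" "\<lambda>j. - Q k j"]
    by (simp add: stochastic_summable P Q summable_on_uminus stochastic_abs_row_sum)
  then show "bdd_above (range (\<lambda>k. \<Sum>\<^sub>\<infinity>j. \<bar>P k j - Q k j\<bar>))"
    by (rule bdd_aboveI2)
qed simp

text \<open>Telescoping: P^(n+1) - Q^(n+1) = (P^n - Q^n) P + Q^n (P - Q). Since P and Q^n have norm
  1, each step adds at most C.\<close>

lemma mat_pow_diff_row_sum_le:
  assumes P: "stochastic P" and Q: "stochastic Q"
    and C: "\<And>i. (\<Sum>\<^sub>\<infinity>j. \<bar>P i j - Q i j\<bar>) \<le> C"
  shows "(\<Sum>\<^sub>\<infinity>j. \<bar>mat_pow P n i j - mat_pow Q n i j\<bar>) \<le> real n * C"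
proof (induction n)
  case 0
  show ?case by simp
next
  case (Suc n)
  note Pn = stochastic_mat_pow[OF P, of n] and Qn = stochastic_mat_pow[OF Q, of n]
  \<comment> \<open>\<open>f\<close> and \<open>g\<close> are row i of the two telescoping terms.
    Multiplication on the right by P uses only row i of P^n - Q^n, so the induction runs with i
    fixed.\<close>
  define f where "f j = (\<Sum>\<^sub>\<infinity>k. (mat_pow P n i k - mat_pow Q n i k) * P k j)" for j
  define g where "g j = (\<Sum>\<^sub>\<infinity>k. mat_pow Q n i k * (P k j - Q k j))" for j
  note fargs = stochastic_diff_summable[OF Pn Qn, of i] stochastic_summable[OF P]
    order_eq_refl[OF stochastic_abs_row_sum[OF P]]
  note gargs = stochastic_summable[OF Qn, of i] stochastic_diff_summable[OF P Q] C
  have f_sum: "f summable_on UNIV"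
    unfolding f_def by (rule row_product_summable[OF fargs])
  have g_sum: "g summable_on UNIV"
    unfolding g_def by (rule row_product_summable[OF gargs])
  have "mat_pow P (Suc n) i j - mat_pow Q (Suc n) i j = f j + g j" for j
  proof -
    have "f j + g j = (\<Sum>\<^sub>\<infinity>k. (mat_pow P n i k - mat_pow Q n i k) * P k j
        + mat_pow Q n i k * (P k j - Q k j))"
      unfolding f_def g_def
      by (rule infsum_add[symmetric])
        (rule row_product_entry_summable[OF fargs] row_product_entry_summable[OF gargs])+
    also have "\<dots> = (\<Sum>\<^sub>\<infinity>k. mat_pow P n i k * P k j - mat_pow Q n i k * Q k j)"
      by (simp add: algebra_simps)
    also have "\<dots> = mat_pow P (Suc n) i j - mat_pow Q (Suc n) i j"
      by (simp add: infsum_diff_real stochastic_row_product_summable stochastic_summable P Q Pn Qn)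
    finally show ?thesis by simp
  qed
  then have "(\<Sum>\<^sub>\<infinity>j. \<bar>mat_pow P (Suc n) i j - mat_pow Q (Suc n) i j\<bar>)
      \<le> (\<Sum>\<^sub>\<infinity>j. \<bar>f j\<bar>) + (\<Sum>\<^sub>\<infinity>j. \<bar>g j\<bar>)"
    using infsum_abs_add_le[OF f_sum g_sum] by (simp del: mat_pow.simps)
  moreover have "(\<Sum>\<^sub>\<infinity>j. \<bar>f j\<bar>) \<le> 1 * (\<Sum>\<^sub>\<infinity>k. \<bar>mat_pow P n i k - mat_pow Q n i k\<bar>)"
    unfolding f_def by (rule infsum_abs_row_product_le[OF fargs])
  moreover have "(\<Sum>\<^sub>\<infinity>j. \<bar>g j\<bar>) \<le> C * (\<Sum>\<^sub>\<infinity>k. \<bar>mat_pow Q n i k\<bar>)"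
    unfolding g_def by (rule infsum_abs_row_product_le[OF gargs])
  ultimately show ?case
    using Suc by (simp add: stochastic_abs_row_sum[OF Qn] algebra_simps del: mat_pow.simps)
qed

lemma mat_norm_mat_pow_diff_le:
  assumes P: "stochastic P" and Q: "stochastic Q"
  shows "mat_norm (\<lambda>i j. mat_pow P n i j - mat_pow Q n i j)
    \<le> real n * mat_norm (\<lambda>i j. P i j - Q i j)"
  unfolding mat_norm_def[of "\<lambda>i j. mat_pow P n i j - mat_pow Q n i j"]
  by (rule cSUP_least)
    (auto intro!: mat_pow_diff_row_sum_le P Q stochastic_diff_row_sum_le_mat_norm)

section \<open>Contraction under a common minorant of the rows\<close>

text \<open>An abstract minorant \<open>d\<close> covers both claims of the theorem: the point
  masses of a small measure and the column infima \<open>delta\<close>.\<close>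

lemma invariant_prob_diff_le:
  assumes P: "stochastic P" and Q: "stochastic Q"
    and \<pi>: "invariant_prob P \<pi>" and \<nu>: "invariant_prob Q \<nu>"
    and d: "\<And>k. 0 \<le> d k" "\<And>i k. d k \<le> mat_pow P m i k"
  shows "(\<Sum>\<^sub>\<infinity>k. d k) * vec_norm (\<lambda>i. \<nu> i - \<pi> i)
    \<le> mat_norm (\<lambda>i j. mat_pow P m i j - mat_pow Q m i j)"
proof -
  note Pm = stochastic_mat_pow[OF P, of m] and Qm = stochastic_mat_pow[OF Q, of m]
  define s where "s = (\<Sum>\<^sub>\<infinity>k. d k)"
  define x where "x i = \<nu> i - \<pi> i" for i
  define N where "N = mat_norm (\<lambda>i j. mat_pow P m i j - mat_pow Q m i j)"
  define f where "f j = (\<Sum>\<^sub>\<infinity>i. x i * (mat_pow P m i j - d j))" for j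
  define g where "g j = (\<Sum>\<^sub>\<infinity>i. \<nu> i * (mat_pow Q m i j - mat_pow P m i j))" for j
  have \<pi>_sum: "\<pi> summable_on UNIV" "(\<Sum>\<^sub>\<infinity>i. \<pi> i) = 1"
    and \<nu>_sum: "\<nu> summable_on UNIV" "(\<Sum>\<^sub>\<infinity>i. \<nu> i) = 1" "(\<Sum>\<^sub>\<infinity>i. \<bar>\<nu> i\<bar>) = 1"
    using \<pi> \<nu> by (auto simp: invariant_prob_def summable_on_def intro: infsumI)
  have x_sum: "x summable_on UNIV" "(\<Sum>\<^sub>\<infinity>i. x i) = 0"
    unfolding x_def using \<pi>_sum \<nu>_sum by (auto simp: infsum_diff_real intro: summable_on_diff_real)
  \<comment> \<open>Domination by a row of P^m makes \<open>s\<close> a genuine sum and not the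
    default value 0 of \<open>infsum\<close>.\<close>
  have d_sum: "d summable_on UNIV"
    by (rule summable_on_comparison_test[OF stochastic_summable[OF Pm]]) (rule d)+
  \<comment> \<open>The entries are nonnegative as \<open>d\<close> lies below each row, so the
    absolute values drop out.\<close>
  have row: "(\<Sum>\<^sub>\<infinity>j. \<bar>mat_pow P m i j - d j\<bar>) = 1 - s" for i
    by (simp add: d infsum_diff_real stochastic_summable Pm d_sum stochastic_row_sum s_def)
  have rowQ: "(\<Sum>\<^sub>\<infinity>j. \<bar>mat_pow Q m i j - mat_pow P m i j\<bar>) \<le> N" for i
    unfolding N_def
    by (subst infsum_abs_minus_commute) (rule stochastic_diff_row_sum_le_mat_norm[OF Pm Qm])
  note fargs = x_sum(1) summable_on_diff_real[OF stochastic_summable[OF Pm] d_sum] order_eq_refl[OF row]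
  note gargs = \<nu>_sum(1) stochastic_diff_summable[OF Qm Pm] rowQ
  have f_sum: "f summable_on UNIV"
    unfolding f_def by (rule row_product_summable[OF fargs])
  have g_sum: "g summable_on UNIV"
    unfolding g_def by (rule row_product_summable[OF gargs])
  have "x j = f j + g j" for j
  proof -
    note [simp] = stochastic_row_product_summable[OF Pm] stochastic_row_product_summable[OF Qm]
      \<pi>_sum(1) \<nu>_sum(1) x_sum(1)
    have "f j = (\<Sum>\<^sub>\<infinity>i. x i * mat_pow P m i j) - (\<Sum>\<^sub>\<infinity>i. x i * d j)"
      unfolding f_def right_diff_distrib by (rule infsum_diff_real) (auto intro: summable_on_cmult_left)
    \<comment> \<open>\<open>d j\<close> does not depend on i and factors out, leaving the total
      mass 0 of \<open>x\<close>.\<close>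
    also have "\<dots> = (\<Sum>\<^sub>\<infinity>i. x i * mat_pow P m i j)"
      by (simp add: infsum_cmult_left' x_sum)
    also have "\<dots> = (\<Sum>\<^sub>\<infinity>i. \<nu> i * mat_pow P m i j) - \<pi> j"
      by (simp add: x_def left_diff_distrib infsum_diff_real invariant_prob_mat_pow[OF P \<pi>])
    moreover have "g j = \<nu> j - (\<Sum>\<^sub>\<infinity>i. \<nu> i * mat_pow P m i j)"
      by (simp add: g_def right_diff_distrib infsum_diff_real invariant_prob_mat_pow[OF Q \<nu>])
    ultimately show ?thesis
      by (simp add: x_def)
  qed
  then have "(\<Sum>\<^sub>\<infinity>j. \<bar>x j\<bar>) \<le> (\<Sum>\<^sub>\<infinity>j. \<bar>f j\<bar>) + (\<Sum>\<^sub>\<infinity>j. \<bar>g j\<bar>)"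
    using infsum_abs_add_le[OF f_sum g_sum] by simp
  moreover have "(\<Sum>\<^sub>\<infinity>j. \<bar>f j\<bar>) \<le> (1 - s) * (\<Sum>\<^sub>\<infinity>j. \<bar>x j\<bar>)"
    using infsum_abs_row_product_le[OF fargs] by (simp add: f_def)
  moreover have "(\<Sum>\<^sub>\<infinity>j. \<bar>g j\<bar>) \<le> N"
    using infsum_abs_row_product_le[OF gargs] by (simp add: g_def \<nu>_sum)
  \<comment> \<open>The term with factor 1 - s is moved to the left side.\<close>
  ultimately have "s * (\<Sum>\<^sub>\<infinity>j. \<bar>x j\<bar>) \<le> N"
    by (simp add: algebra_simps)
  then show ?thesis
    by (simp add: s_def x_def N_def vec_norm_def)
qed

section \<open>Minorants from small measures\<close>

text \<open>The sets B = {k} show that the point masses form a minorant of the rows of P^m;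
  countability of the state space makes them add up to the total mass.\<close>

lemma space_small_minorant:
  fixes M :: "'a::countable measure"
  assumes P: "stochastic P" and small: "space_small P m M"
  shows "measure M {k} \<le> mat_pow P m i k"
    and "(\<Sum>\<^sub>\<infinity>k. measure M {k}) = measure M UNIV"
    and "0 < measure M UNIV"
proof -
  have sets: "sets M = UNIV" and pos: "0 < emeasure M UNIV"
    and le: "\<And>i B. emeasure M B \<le> ennreal (\<Sum>\<^sub>\<infinity>k\<in>B. mat_pow P m i k)"
    using small by (auto simp: space_small_def)
  have space: "space M = UNIV"
    using sets sets.sets_into_space[of UNIV M] by auto
  \<comment> \<open>B = UNIV bounds the total mass by a real number; \<open>undefined\<close> is
    just some state.\<close>
  have fin: "emeasure M UNIV \<noteq> \<infinity>"
    using le[of UNIV undefined] by (auto simp: top_unique)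
  interpret finite_measure M
    by (rule finite_measureI) (use fin space in simp)
  show "measure M {k} \<le> mat_pow P m i k"
    using le[of "{k}" i] stochastic_nonneg[OF stochastic_mat_pow[OF P]]
    by (simp add: emeasure_eq_measure)
  show "0 < measure M UNIV"
    using pos by (simp add: emeasure_eq_measure)
  \<comment> \<open>Countable additivity over singletons, as an integral for counting measure; it is
    then carried over to the Bochner integral and to \<open>infsum\<close>.\<close>
  have nn: "(\<integral>\<^sup>+k. ennreal (measure M {k}) \<partial>count_space UNIV) = ennreal (measure M UNIV)"
    using emeasure_countable_singleton[of UNIV M] sets by (simp add: emeasure_eq_measure)
  then have int: "integrable (count_space UNIV) (\<lambda>k. measure M {k})"
    by (intro integrableI_nonneg) auto
  then have "Infinite_Set_Sum.abs_summable_on (\<lambda>k. measure M {k}) UNIV"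
    by (simp add: Infinite_Set_Sum.abs_summable_on_def)
  from infsetsum_infsum[OF this]
  have "(\<Sum>\<^sub>\<infinity>k. measure M {k}) = (LINT k|count_space UNIV. measure M {k})"
    by (simp add: infsetsum_def)
  also have "\<dots> = measure M UNIV"
    using nn by (subst integral_eq_nn_integral) auto
  finally show "(\<Sum>\<^sub>\<infinity>k. measure M {k}) = measure M UNIV" .
qed

theorem theorem2p1:
  fixes P P' \<Delta> :: "'a::countable \<Rightarrow> 'a \<Rightarrow> real"
    and \<pi> \<nu> :: "'a \<Rightarrow> real"
  assumes "stochastic P" and "irreducible_mat P" and "positive_recurrent P"
    and "stochastic P'" and "irreducible_mat P'" and "positive_recurrent P'"
    and "invariant_prob P \<pi>" and "invariant_prob P' \<nu>"
    and "\<Delta> = (\<lambda>i j. P' i j - P i j)"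
  shows
    "(\<forall>(m::nat) (M::'a measure). 0 < m \<and> space_small P m M \<longrightarrow>
        vec_norm (\<lambda>i. \<nu> i - \<pi> i)
          \<le> mat_norm (\<lambda>i j. mat_pow P m i j - mat_pow P' m i j) / measure M UNIV \<and>
        mat_norm (\<lambda>i j. mat_pow P m i j - mat_pow P' m i j) / measure M UNIV
          \<le> real m / measure M UNIV * mat_norm \<Delta>) \<and>
     (\<forall>m::nat. 0 < m \<and> 0 < (\<Sum>\<^sub>\<infinity>k. delta P m k) \<longrightarrow>
        vec_norm (\<lambda>i. \<nu> i - \<pi> i)
          \<le> mat_norm (\<lambda>i j. mat_pow P m i j - mat_pow P' m i j) / (\<Sum>\<^sub>\<infinity>k. delta P m k) \<and>
        mat_norm (\<lambda>i j. mat_pow P m i j - mat_pow P' m i j) / (\<Sum>\<^sub>\<infinity>k. delta P m k)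
          \<le> real m / (\<Sum>\<^sub>\<infinity>k. delta P m k) * mat_norm \<Delta>)"
proof -
  note P = \<open>stochastic P\<close> and P' = \<open>stochastic P'\<close>
  let ?D = "\<lambda>m i j. mat_pow P m i j - mat_pow P' m i j"
  \<comment> \<open>\<Delta> is P' - P, while the telescoping bound concerns P - P'; the norm
    ignores the sign.\<close>
  have "mat_norm \<Delta> = mat_norm (\<lambda>i j. P i j - P' i j)"
    by (simp add: mat_norm_def assms(9) abs_minus_commute)
  then have pow: "mat_norm (?D m) \<le> real m * mat_norm \<Delta>" for m
    using mat_norm_mat_pow_diff_le[OF P P'] by simp
  \<comment> \<open>Both pairs of inequalities for an arbitrary minorant \<open>d\<close> of
    positive mass \<open>s\<close>, used at the end once with point masses and once with
    \<open>delta\<close>.\<close>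
  have main: "vec_norm (\<lambda>i. \<nu> i - \<pi> i) \<le> mat_norm (?D m) / s \<and>
      mat_norm (?D m) / s \<le> real m / s * mat_norm \<Delta>"
    if "0 < s" "(\<Sum>\<^sub>\<infinity>k. d k) = s" "\<And>k. 0 \<le> d k" "\<And>i k. d k \<le> mat_pow P m i k" for m s d
    using invariant_prob_diff_le[OF P P' assms(7,8) that(3,4)] pow[of m] that(1,2)
    by (auto simp: field_simps)
  have nonneg: "0 \<le> mat_pow P m i k" for m i k
    by (rule stochastic_nonneg[OF stochastic_mat_pow[OF P]])
  have delta_nonneg: "0 \<le> delta P m k" for m k
    unfolding delta_def by (rule cINF_greatest) (auto simp: nonneg)
  \<comment> \<open>The infimum is a lower bound because the entries of P^m are bounded below by
    0.\<close>
  have delta_le: "delta P m k \<le> mat_pow P m i k" for m k i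
    unfolding delta_def by (rule cINF_lower) (auto intro: bdd_belowI2 nonneg)
  show ?thesis
    using main[OF space_small_minorant(3,2)[OF P] measure_nonneg space_small_minorant(1)[OF P]]
      main[OF _ refl delta_nonneg delta_le] by auto
qed

end
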